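(* Let $f_1,\dots,f_M:\mathbb{R}^d\to\mathbb{R}$ be twice differentiable, let $p$ be a probability distribution on $\{1,\dots,M\}$ and let $\alpha>0$. Consider the MAML iteration $w^+ = w-\beta\nabla F(w)$ with step size $\beta>0$, where $F(w)=\mathbb{E}_{i\sim p}[f_i(w-\alpha\nabla f_i(w))]$. Then the continuous-time limit ($\beta\to 0$ with $\alpha$ fixed) of MAML is the ordinary differential equation $$\dot w=-\nabla F(w) = -\nabla f(w)+\mathbb{E}_{i\sim p}[B_i(w)\nabla f_i(w)],$$ where $f=\mathbb{E}_{i\sim p}f_i$, $$B_i(w)=\alpha\big(\nabla^2 f_i(w)+\nabla^2 f_i(\tilde w_i)\big)-\alpha^2\nabla^2 f_i(w)\nabla^2 f_i(\tilde w_i),$$ and $\tilde w_i$ is a convex combination of $w$ and $w-\alpha\nabla f_i(w)$.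
   Context: $\mathbb{E}_{i\sim p}$ denotes expectation over the task index $i\in\{1,\dots,M\}$ drawn from $p$. $\nabla F(w)=\mathbb{E}_{i\sim p}[(I_d-\alpha\nabla^2 f_i(w))\nabla f_i(w-\alpha\nabla f_i(w))]$. The continuous-time limit of the iteration $w^+=w-\beta\nabla F(w)$ as $\beta\to0$ is the gradient flow $\dot w=-\nabla F(w)$; the point $\tilde w_i$ depends on $w$ and $i$.
   Formalization: For d ≥ 2 a single point w̃_i need not exist (no mean value theorem for vector fields), so each row of ∇²f_i(w̃_i) is taken at its own convex combination of w and w−α∇f_i(w); for d=1 this is the stated formula. *)

theory Defs
  imports "HOL-Probability.Probability"
begin

text \<open>The two operators below carry their usual meaning only at points where \<open>f\<close> is once,
  respectively twice, differentiable.\<close>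

definition grad :: "('a::real_inner \<Rightarrow> real) \<Rightarrow> 'a \<Rightarrow> 'a" where
  "grad f x = (THE D. GDERIV f x :> D)"

definition hessian :: "(real ^ 'n \<Rightarrow> real) \<Rightarrow> real ^ 'n \<Rightarrow> real ^ 'n ^ 'n" where
  "hessian f x = jacobian (grad f) (at x)"

text \<open>No continuity of the second derivative is required.\<close>

definition twice_differentiable :: "(real ^ 'n \<Rightarrow> real) \<Rightarrow> bool" where
  "twice_differentiable f \<longleftrightarrow>
     (\<forall>x. f differentiable (at x)) \<and> (\<forall>x. grad f differentiable (at x))"

definition avg_loss :: "nat pmf \<Rightarrow> (nat \<Rightarrow> real ^ 'n \<Rightarrow> real) \<Rightarrow> real ^ 'n \<Rightarrow> real" where
  "avg_loss p f w = measure_pmf.expectation p (\<lambda>i. f i w)"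

definition maml_objective ::
    "real \<Rightarrow> nat pmf \<Rightarrow> (nat \<Rightarrow> real ^ 'n \<Rightarrow> real) \<Rightarrow> real ^ 'n \<Rightarrow> real" where
  "maml_objective \<alpha> p f w = measure_pmf.expectation p (\<lambda>i. f i (w - \<alpha> *\<^sub>R grad (f i) w))"

definition maml_step ::
    "real \<Rightarrow> nat pmf \<Rightarrow> (nat \<Rightarrow> real ^ 'n \<Rightarrow> real) \<Rightarrow> real \<Rightarrow> real ^ 'n \<Rightarrow> real ^ 'n" where
  "maml_step \<alpha> p f \<beta> w = w - \<beta> *\<^sub>R grad (maml_objective \<alpha> p f) w"

text \<open>The mean value theorem holds for each component of the vector field \<open>grad f\<close> separately,
  with an intermediate point that depends on the component; a single intermediate point serving
  all components need not exist in dimension at least 2. Hence the Hessian at an intermediate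
  point is read row by row: row \<open>j\<close> is the \<open>j\<close>-th row of the Hessian at the point \<open>z j\<close>. For a
  constant family \<open>z = (\<lambda>_. y)\<close>, in particular in dimension 1, this is \<open>hessian f y\<close>.\<close>

definition rowwise_hessian ::
    "(real ^ 'n \<Rightarrow> real) \<Rightarrow> ('n \<Rightarrow> real ^ 'n) \<Rightarrow> real ^ 'n ^ 'n" where
  "rowwise_hessian f z = (\<chi> j. hessian f (z j) $ j)"

definition maml_B ::
    "real \<Rightarrow> (real ^ 'n \<Rightarrow> real) \<Rightarrow> real ^ 'n \<Rightarrow> ('n \<Rightarrow> real ^ 'n) \<Rightarrow> real ^ 'n ^ 'n" where
  "maml_B \<alpha> f w z =
     \<alpha> *\<^sub>R (hessian f w + rowwise_hessian f z) - \<alpha>\<^sup>2 *\<^sub>R (hessian f w ** rowwise_hessian f z)"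

definition ode_solution ::
    "('a::real_normed_vector \<Rightarrow> 'a) \<Rightarrow> real \<Rightarrow> (real \<Rightarrow> 'a) \<Rightarrow> bool" where
  "ode_solution V S x \<longleftrightarrow>
     (\<forall>t\<in>{0..S}. (x has_vector_derivative V (x t)) (at t within {0..S}))"

text \<open>The iterates of the step map \<open>T \<beta>\<close>, placed on the time axis with spacing \<open>\<beta>\<close>.\<close>

definition iterate_path :: "(real \<Rightarrow> 'a \<Rightarrow> 'a) \<Rightarrow> real \<Rightarrow> 'a \<Rightarrow> real \<Rightarrow> 'a" where
  "iterate_path T \<beta> w0 t = (T \<beta> ^^ nat \<lfloor>t / \<beta>\<rfloor>) w0"

text \<open>The ODE with right-hand side \<open>V\<close> is the limit of the iterations \<open>w \<mapsto> T \<beta> w\<close> as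
  \<open>\<beta>\<close> tends to 0 from above: the difference quotient of a step tends to \<open>V\<close>; limits of the
  iterate paths solve the ODE; the iterate paths converge to the solutions of the ODE. The last
  two clauses carry the regularity of \<open>V\<close> without which they fail even for explicit Euler steps
  \<open>T \<beta> w = w + \<beta> V(w)\<close>: for discontinuous \<open>V\<close> a limit of iterate paths need not be a solution,
  and for non-Lipschitz \<open>V\<close> there may be several solutions with the same initial value.\<close>

definition continuous_time_limit ::
    "(real \<Rightarrow> 'a \<Rightarrow> 'a) \<Rightarrow> ('a::euclidean_space \<Rightarrow> 'a) \<Rightarrow> bool" where
  "continuous_time_limit T V \<longleftrightarrow>
     (\<forall>w. ((\<lambda>\<beta>. (T \<beta> w - w) /\<^sub>R \<beta>) \<longlongrightarrow> V w) (at_right 0)) \<and>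
     (continuous_on UNIV V \<longrightarrow>
        (\<forall>S>0. \<forall>w0 x. \<forall>\<beta>::nat \<Rightarrow> real.
           (\<forall>n. \<beta> n > 0) \<and> \<beta> \<longlonglongrightarrow> 0 \<and>
           uniform_limit {0..S} (\<lambda>n. iterate_path T (\<beta> n) w0) x sequentially
           \<longrightarrow> ode_solution V S x \<and> x 0 = w0)) \<and>
     (local_lipschitz (UNIV :: real set) UNIV (\<lambda>_. V) \<longrightarrow>
        (\<forall>S>0. \<forall>w0 x. ode_solution V S x \<and> x 0 = w0
           \<longrightarrow> uniform_limit {0..S} (\<lambda>\<beta>. iterate_path T \<beta> w0) x (at_right 0)))"

end

theory Submission
  imports Defs
begin

text \<open>Since the derivative of \<open>grad f\<close> at a point is symmetric even without continuity, the chain rule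
  gives \<open>grad F\<close> as the mean of \<open>(I - \<alpha> H\<^sub>i(w)) g\<^sub>i(w - \<alpha> g\<^sub>i(w))\<close>; the mean value theorem for each
  component of \<open>g\<^sub>i\<close> replaces the inner gradient by \<open>g\<^sub>i(w) - \<alpha> R\<^sub>i g\<^sub>i(w)\<close>, with \<open>R\<^sub>i\<close> the row-wise
  Hessian, and expanding the product produces \<open>B\<^sub>i\<close>. MAML is explicit Euler for \<open>- grad F\<close>. A uniform
  limit of Euler paths solves the ODE because the drift of a path over a short time interval
  is the length of the interval times nearly constant values of the vector field. Conversely, Euler
  paths converge to a given solution by consistency and a discrete Gronwall estimate in a ball
  around that solution, where the vector field is Lipschitz.\<close>

section \<open>Gradients, symmetry of second derivatives, mean values on segments\<close>

lemma differentiable_GDERIV_exists: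
  fixes f :: "'a::euclidean_space \<Rightarrow> real"
  assumes "f differentiable (at x)"
  obtains D where "GDERIV f x :> D"
proof -
  from assms obtain f' where f': "(f has_derivative f') (at x)"
    by (auto simp: differentiable_def)
  \<comment> \<open>\<open>adjoint f' 1\<close> is the Riesz representative of the functional
    \<open>f'\<close>.\<close>
  have "f' = (\<lambda>h. h \<bullet> adjoint f' 1)"
    using adjoint_works[OF has_derivative_linear[OF f'], of _ 1] by auto
  then have "GDERIV f x :> adjoint f' 1"
    using f' by (metis gderiv_def)
  then show thesis ..
qed

lemma GDERIV_unique:
  assumes "GDERIV f x :> D" and "GDERIV f x :> E"
  shows "D = E"
proof -
  have "(\<lambda>h. h \<bullet> D) = (\<lambda>h. h \<bullet> E)"
    using assms unfolding gderiv_def by (rule has_derivative_unique)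
  then have "(D - E) \<bullet> D = (D - E) \<bullet> E" by metis
  then have "(D - E) \<bullet> (D - E) = 0" by (simp add: inner_diff_right)
  then show ?thesis by simp
qed

lemma grad_eq:
  assumes "GDERIV f x :> D"
  shows "grad f x = D"
  unfolding grad_def using assms GDERIV_unique by blast

lemma differentiable_GDERIV_grad:
  fixes f :: "'a::euclidean_space \<Rightarrow> real"
  assumes "f differentiable (at x)"
  shows "GDERIV f x :> grad f x"
  using assms differentiable_GDERIV_exists grad_eq by metis

lemma has_derivative_grad_hessian:
  assumes "grad f differentiable (at x)"
  shows "(grad f has_derivative (\<lambda>h. hessian f x *v h)) (at x)"
  using assms unfolding hessian_def jacobian_works .

text \<open>The double difference is symmetric in \<open>u\<close> and \<open>v\<close>, and the mean value theorem along \<open>u\<close>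
  approximates it by \<open>u \<bullet> A v\<close>; no continuity of the second derivative is involved.\<close>

lemma second_difference_bound:
  fixes f :: "'a::real_inner \<Rightarrow> real"
  assumes grad: "\<And>y. GDERIV f y :> g y"
    and A: "bounded_linear A"
    and near: "\<And>y. norm (y - x) \<le> norm u + norm v \<Longrightarrow>
                 norm (g y - g x - A (y - x)) \<le> e * norm (y - x)"
    and "0 \<le> e"
  shows "\<bar>f (x + u + v) - f (x + u) - f (x + v) + f x - u \<bullet> A v\<bar> \<le> 2 * e * (norm u + norm v)\<^sup>2"
proof -
  interpret A: bounded_linear A by (fact A)
  \<comment> \<open>Only the \<open>u\<close> direction is traversed, so
    \<open>\<phi> 1 - \<phi> 0\<close> is the whole double difference and \<open>\<phi>'\<close> is
    a difference of two gradients a fixed \<open>v\<close> apart.\<close>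
  define \<phi> where "\<phi> s = f (x + s *\<^sub>R u + v) - f (x + s *\<^sub>R u)" for s :: real
  define \<phi>' where "\<phi>' s = u \<bullet> (g (x + s *\<^sub>R u + v) - g (x + s *\<^sub>R u))" for s :: real
  have f: "(f has_derivative (\<lambda>h. h \<bullet> g y)) (at y)" for y
    using grad unfolding gderiv_def .
  have "(\<phi> has_real_derivative \<phi>' s) (at s)" for s
    unfolding \<phi>_def \<phi>'_def has_field_derivative_def
    by (auto intro!: derivative_eq_intros has_derivative_compose[OF _ f]
        simp: inner_diff_right algebra_simps fun_eq_iff)
  then obtain s where s: "0 < s" "s < 1" and \<phi>: "\<phi> 1 - \<phi> 0 = \<phi>' s"
    using MVT2[of 0 1 \<phi> \<phi>'] by auto
  have diff: "\<phi> 1 - \<phi> 0 = f (x + u + v) - f (x + u) - f (x + v) + f x"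
    by (simp add: \<phi>_def)
  \<comment> \<open>\<open>r\<close> is the first-order remainder of \<open>g\<close> at
    \<open>x\<close>. When both gradients in \<open>\<phi>' s\<close> are expanded at
    \<open>x\<close>, their linear parts differ by exactly \<open>A v\<close>, so only two
    remainders are left.\<close>
  define r where "r y = g y - g x - A (y - x)" for y
  have r: "norm (r (x + h)) \<le> e * (norm u + norm v)" if "norm h \<le> norm u + norm v" for h
    using near[of "x + h"] mult_left_mono[OF that \<open>0 \<le> e\<close>] that by (simp add: r_def)
  have su: "norm (s *\<^sub>R u) \<le> norm u"
    using s by (simp add: mult_left_le_one_le)
  have "\<phi>' s - u \<bullet> A v = u \<bullet> (r (x + (s *\<^sub>R u + v)) - r (x + s *\<^sub>R u))"
    unfolding \<phi>'_def r_def by (simp add: algebra_simps A.add inner_diff_right inner_add_right)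
  then have "\<bar>\<phi>' s - u \<bullet> A v\<bar> \<le> norm u * norm (r (x + (s *\<^sub>R u + v)) - r (x + s *\<^sub>R u))"
    by (simp add: Cauchy_Schwarz_ineq2)
  also have "\<dots> \<le> norm u * (e * (norm u + norm v) + e * (norm u + norm v))"
  proof (intro mult_left_mono order.trans[OF norm_triangle_ineq4] add_mono r)
    show "norm (s *\<^sub>R u + v) \<le> norm u + norm v"
      using norm_triangle_ineq[of "s *\<^sub>R u" v] su by linarith
    show "norm (s *\<^sub>R u) \<le> norm u + norm v"
      using su norm_ge_zero[of v] by linarith
  qed simp
  \<comment> \<open>Enlarging the factor \<open>norm u\<close> makes the bound symmetric, so that it
    serves for both orders of \<open>u\<close> and \<open>v\<close>.\<close>
  also have "\<dots> \<le> (norm u + norm v) * (e * (norm u + norm v) + e * (norm u + norm v))"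
    using \<open>0 \<le> e\<close> by (intro mult_right_mono) auto
  also have "\<dots> = 2 * e * (norm u + norm v)\<^sup>2"
    by (simp add: power2_eq_square algebra_simps)
  finally show ?thesis
    using \<phi> diff by simp
qed

text \<open>At \<open>t u\<close> and \<open>t v\<close> both bilinear values approximate the same
  double difference. The error and the difference of the two values both scale like the square of
  \<open>t\<close>, which cancels and leaves an arbitrarily small bound.\<close>

lemma gradient_derivative_symmetric:
  fixes f :: "'a::real_inner \<Rightarrow> real"
  assumes grad: "\<And>y. GDERIV f y :> g y" and A: "(g has_derivative A) (at x)"
  shows "u \<bullet> A v = v \<bullet> A u"
proof -
  have lin: "bounded_linear A" using A by (rule has_derivative_bounded_linear)
  interpret A: bounded_linear A by (fact lin)
  have bound: "\<bar>u \<bullet> A v - v \<bullet> A u\<bar> \<le> 4 * (norm u + norm v)\<^sup>2 * e" if "e > 0" for e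
  proof -
    from A \<open>e > 0\<close> obtain d where "d > 0"
      and d: "\<And>y. norm (y - x) < d \<Longrightarrow> norm (g y - g x - A (y - x)) \<le> e * norm (y - x)"
      unfolding has_derivative_at_alt by blast
    define N where "N = norm u + norm v"
    \<comment> \<open>The scaling keeps all points of the double difference within \<open>d\<close>
      of \<open>x\<close>; the summand 1 covers \<open>N = 0\<close>.\<close>
    define t where "t = d / (N + 1)"
    have "N \<ge> 0" by (simp add: N_def)
    then have t: "t > 0" "t * N < d"
      using \<open>d > 0\<close> by (auto simp: t_def field_simps)
    have near: "norm (g y - g x - A (y - x)) \<le> e * norm (y - x)" if "norm (y - x) \<le> t * N" for y
      using d that t by force
    have tN: "norm (t *\<^sub>R a) + norm (t *\<^sub>R b) = t * (norm a + norm b)" for a b :: 'a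
      using t by (simp add: algebra_simps)
    let ?D = "f (x + t *\<^sub>R u + t *\<^sub>R v) - f (x + t *\<^sub>R u) - f (x + t *\<^sub>R v) + f x"
    have "\<bar>?D - (t *\<^sub>R u) \<bullet> A (t *\<^sub>R v)\<bar> \<le> 2 * e * (t * N)\<^sup>2"
      using second_difference_bound[OF grad lin, of x "t *\<^sub>R u" "t *\<^sub>R v" e, unfolded tN]
        near \<open>e > 0\<close> by (simp add: N_def)
    moreover have "\<bar>?D - (t *\<^sub>R v) \<bullet> A (t *\<^sub>R u)\<bar> \<le> 2 * e * (t * N)\<^sup>2"
      using second_difference_bound[OF grad lin, of x "t *\<^sub>R v" "t *\<^sub>R u" e, unfolded tN]
        near \<open>e > 0\<close> by (simp add: N_def algebra_simps)
    ultimately have "\<bar>(t *\<^sub>R u) \<bullet> A (t *\<^sub>R v) - (t *\<^sub>R v) \<bullet> A (t *\<^sub>R u)\<bar> \<le> 4 * e * (t * N)\<^sup>2"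
      by linarith
    moreover have "(t *\<^sub>R u) \<bullet> A (t *\<^sub>R v) - (t *\<^sub>R v) \<bullet> A (t *\<^sub>R u) = t\<^sup>2 * (u \<bullet> A v - v \<bullet> A u)"
      by (simp add: A.scaleR power2_eq_square algebra_simps)
    ultimately have "\<bar>t\<^sup>2 * (u \<bullet> A v - v \<bullet> A u)\<bar> \<le> 4 * e * (t * N)\<^sup>2"
      by simp
    then have "t\<^sup>2 * \<bar>u \<bullet> A v - v \<bullet> A u\<bar> \<le> t\<^sup>2 * (4 * N\<^sup>2 * e)"
      by (simp add: abs_mult power_mult_distrib mult_ac)
    then show ?thesis
      using t by (simp add: N_def)
  qed
  have "\<bar>u \<bullet> A v - v \<bullet> A u\<bar> \<le> 0"
  proof (rule field_le_epsilon)
    fix e :: real assume "e > 0"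
    define C where "C = 4 * (norm u + norm v)\<^sup>2"
    have C: "C \<ge> 0" by (simp add: C_def)
    then have "C * (e / (C + 1)) \<le> e"
      using \<open>e > 0\<close> by (simp add: field_simps)
    moreover have "\<bar>u \<bullet> A v - v \<bullet> A u\<bar> \<le> C * (e / (C + 1))"
      using bound[of "e / (C + 1)"] C \<open>e > 0\<close> by (simp add: C_def[symmetric])
    ultimately show "\<bar>u \<bullet> A v - v \<bullet> A u\<bar> \<le> 0 + e" by linarith
  qed
  then show ?thesis by simp
qed

lemma mvt_closed_segment:
  fixes f :: "'a::real_normed_vector \<Rightarrow> real"
  assumes f: "\<And>y. (f has_derivative f' y) (at y)"
  obtains z where "z \<in> closed_segment a b" and "f b - f a = f' z (b - a)"
proof -
  have "((\<lambda>t. f (a + t *\<^sub>R (b - a))) has_derivative (\<lambda>h. f' (a + t *\<^sub>R (b - a)) (h *\<^sub>R (b - a))))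
      (at t within {0..1})" for t :: real
    by (rule has_derivative_compose[OF _ f]) (auto intro!: derivative_eq_intros)
  then obtain t where t: "t \<in> {0..1}"
    and "f (a + 1 *\<^sub>R (b - a)) - f (a + 0 *\<^sub>R (b - a)) = f' (a + t *\<^sub>R (b - a)) ((1 - 0) *\<^sub>R (b - a))"
    using mvt_very_simple[of 0 1 "\<lambda>t. f (a + t *\<^sub>R (b - a))"
        "\<lambda>t h. f' (a + t *\<^sub>R (b - a)) (h *\<^sub>R (b - a))"] by fastforce
  moreover have "a + t *\<^sub>R (b - a) \<in> closed_segment a b"
    using t by (auto simp: in_segment algebra_simps)
  ultimately show thesis using that by simp
qed

section \<open>Explicit Euler iterates on the time axis\<close>

lemma floor_div_bounds:
  fixes \<beta> t :: real
  assumes "\<beta> > 0" and "t \<ge> 0"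
  shows "\<beta> * real (nat \<lfloor>t / \<beta>\<rfloor>) \<le> t" and "t < \<beta> * real (nat \<lfloor>t / \<beta>\<rfloor>) + \<beta>"
proof -
  have "of_int \<lfloor>t / \<beta>\<rfloor> \<le> t / \<beta>" "t / \<beta> < of_int \<lfloor>t / \<beta>\<rfloor> + 1"
    by linarith+
  then have "of_int \<lfloor>t / \<beta>\<rfloor> * \<beta> \<le> t" "t < (of_int \<lfloor>t / \<beta>\<rfloor> + 1) * \<beta>"
    using \<open>\<beta> > 0\<close> pos_le_divide_eq pos_divide_less_eq by blast+
  then show "\<beta> * real (nat \<lfloor>t / \<beta>\<rfloor>) \<le> t" "t < \<beta> * real (nat \<lfloor>t / \<beta>\<rfloor>) + \<beta>"
    using assms by (simp_all add: algebra_simps)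
qed

locale euler_scheme =
  fixes V :: "'a::euclidean_space \<Rightarrow> 'a" and w0 :: 'a
begin

definition euler_step :: "real \<Rightarrow> 'a \<Rightarrow> 'a" where
  "euler_step \<beta> w = w + \<beta> *\<^sub>R V w"

definition euler_iter :: "real \<Rightarrow> nat \<Rightarrow> 'a" where
  "euler_iter \<beta> k = (euler_step \<beta> ^^ k) w0"

abbreviation euler_path :: "real \<Rightarrow> real \<Rightarrow> 'a" where
  "euler_path \<beta> \<equiv> iterate_path euler_step \<beta> w0"

lemma euler_iter_0 [simp]: "euler_iter \<beta> 0 = w0"
  by (simp add: euler_iter_def)

lemma euler_iter_Suc [simp]: "euler_iter \<beta> (Suc k) = euler_iter \<beta> k + \<beta> *\<^sub>R V (euler_iter \<beta> k)"
  by (simp add: euler_iter_def euler_step_def)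

lemma euler_path_eq: "euler_path \<beta> t = euler_iter \<beta> (nat \<lfloor>t / \<beta>\<rfloor>)"
  by (simp add: iterate_path_def euler_iter_def)

text \<open>Each of the \<open>l - k\<close> increments is \<beta> times a value of \<open>V\<close>
  within \<open>e\<close> of \<open>v\<close>, so the deviations add up linearly.\<close>

lemma euler_iter_drift:
  assumes "0 \<le> \<beta>" and "k \<le> l"
    and "\<And>j. k \<le> j \<Longrightarrow> j < l \<Longrightarrow> norm (V (euler_iter \<beta> j) - v) \<le> e"
  shows "norm (euler_iter \<beta> l - euler_iter \<beta> k - (\<beta> * (real l - real k)) *\<^sub>R v)
           \<le> \<beta> * (real l - real k) * e"
  using assms(2,3)
proof (induction l rule: dec_induct)
  case (step l)
  let ?y = "euler_iter \<beta>"
  have "?y (Suc l) - ?y k - (\<beta> * (real (Suc l) - real k)) *\<^sub>R v =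
      (?y l - ?y k - (\<beta> * (real l - real k)) *\<^sub>R v) + \<beta> *\<^sub>R (V (?y l) - v)"
    by (simp add: algebra_simps)
  also have "norm \<dots> \<le> \<beta> * (real l - real k) * e + \<beta> * e"
    using step \<open>0 \<le> \<beta>\<close>
    by (intro norm_triangle_le add_mono) (auto intro!: mult_left_mono)
  finally show ?case
    by (simp add: algebra_simps)
qed simp

text \<open>The path at time \<open>a\<close> is the iterate at the last grid time not after
  \<open>a\<close>, which may precede \<open>a\<close> by almost \<beta>; hence the window for
  \<open>r\<close> opens at \<open>a - \<beta>\<close>. The number \<delta> is the elapsed grid
  time, \<open>b - a\<close> up to rounding.\<close>

lemma euler_path_drift:
  assumes "0 < \<beta>" "0 \<le> a" "a \<le> b"
    and V: "\<And>r. 0 \<le> r \<Longrightarrow> a - \<beta> < r \<Longrightarrow> r \<le> b \<Longrightarrow> norm (V (euler_path \<beta> r) - v) \<le> e"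
  defines "\<delta> \<equiv> \<beta> * (real (nat \<lfloor>b / \<beta>\<rfloor>) - real (nat \<lfloor>a / \<beta>\<rfloor>))"
  shows "norm (euler_path \<beta> b - euler_path \<beta> a - \<delta> *\<^sub>R v) \<le> \<delta> * e"
  unfolding euler_path_eq \<delta>_def
proof (rule euler_iter_drift)
  show "nat \<lfloor>a / \<beta>\<rfloor> \<le> nat \<lfloor>b / \<beta>\<rfloor>"
    using assms by (intro nat_mono floor_mono divide_right_mono) auto
next
  fix j assume j: "nat \<lfloor>a / \<beta>\<rfloor> \<le> j" "j < nat \<lfloor>b / \<beta>\<rfloor>"
  have "\<beta> * real (nat \<lfloor>a / \<beta>\<rfloor>) \<le> \<beta> * real j" "\<beta> * real j \<le> \<beta> * real (nat \<lfloor>b / \<beta>\<rfloor>)"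
    using j \<open>0 < \<beta>\<close> by auto
  moreover have "euler_path \<beta> (\<beta> * real j) = euler_iter \<beta> j"
    using \<open>0 < \<beta>\<close> by (simp add: euler_path_eq)
  moreover have "a - \<beta> < \<beta> * real j" "\<beta> * real j \<le> b"
    using calculation(1,2) floor_div_bounds[of \<beta> a] floor_div_bounds[of \<beta> b] assms(1-3)
    by linarith+
  ultimately show "norm (V (euler_iter \<beta> j) - v) \<le> e"
    using V[of "\<beta> * real j"] \<open>0 < \<beta>\<close> by simp
qed (use assms in auto)

section \<open>Uniform limits of Euler paths\<close>

text \<open>Rounding a time down to the grid moves it by less than \<open>\<beta> n\<close>, so the
  elapsed grid time tends to \<open>b - a\<close> and the drift bound survives in the limit. It
  serves twice: with \<open>v = 0\<close> for a Lipschitz bound on \<open>x\<close>, and with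
  \<open>v = V (x t)\<close> for the derivative.\<close>

lemma limit_drift:
  fixes \<beta> :: "nat \<Rightarrow> real"
  assumes \<beta>: "\<And>n. \<beta> n > 0" "\<beta> \<longlonglongrightarrow> 0" and "0 \<le> a" "a \<le> b"
    and lim: "(\<lambda>n. euler_path (\<beta> n) a) \<longlonglongrightarrow> x a" "(\<lambda>n. euler_path (\<beta> n) b) \<longlonglongrightarrow> x b"
    and V: "\<forall>\<^sub>F n in sequentially. \<forall>r. 0 \<le> r \<longrightarrow> a - \<beta> n < r \<longrightarrow> r \<le> b \<longrightarrow>
              norm (V (euler_path (\<beta> n) r) - v) \<le> e"
  shows "norm (x b - x a - (b - a) *\<^sub>R v) \<le> (b - a) * e"
proof -
  have round: "(\<lambda>n. \<beta> n * real (nat \<lfloor>t / \<beta> n\<rfloor>)) \<longlonglongrightarrow> t" if "t \<ge> 0" for t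
  proof (rule tendsto_sandwich)
    show "(\<lambda>n. t - \<beta> n) \<longlonglongrightarrow> t"
      using tendsto_diff[OF tendsto_const \<beta>(2), of t] by simp
    show "\<forall>\<^sub>F n in sequentially. t - \<beta> n \<le> \<beta> n * real (nat \<lfloor>t / \<beta> n\<rfloor>)"
      using floor_div_bounds(2)[OF \<beta>(1) that] by (simp add: algebra_simps less_imp_le)
    show "\<forall>\<^sub>F n in sequentially. \<beta> n * real (nat \<lfloor>t / \<beta> n\<rfloor>) \<le> t"
      using floor_div_bounds(1)[OF \<beta>(1) that] by simp
  qed simp
  define \<delta> where "\<delta> n = \<beta> n * (real (nat \<lfloor>b / \<beta> n\<rfloor>) - real (nat \<lfloor>a / \<beta> n\<rfloor>))" for n
  have \<delta>: "\<delta> \<longlonglongrightarrow> b - a"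
    unfolding \<delta>_def right_diff_distrib using assms by (intro tendsto_diff round) auto
  show ?thesis
  proof (rule tendsto_le[OF sequentially_bot])
    show "(\<lambda>n. \<delta> n * e) \<longlonglongrightarrow> (b - a) * e"
      by (intro tendsto_intros \<delta>)
    show "(\<lambda>n. norm (euler_path (\<beta> n) b - euler_path (\<beta> n) a - \<delta> n *\<^sub>R v))
        \<longlonglongrightarrow> norm (x b - x a - (b - a) *\<^sub>R v)"
      by (intro tendsto_intros lim \<delta>)
    show "\<forall>\<^sub>F n in sequentially.
        norm (euler_path (\<beta> n) b - euler_path (\<beta> n) a - \<delta> n *\<^sub>R v) \<le> \<delta> n * e"
      using V
    proof eventually_elim
      case (elim n)
      then show ?case
        unfolding \<delta>_def using \<beta>(1) assms by (intro euler_path_drift) auto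
    qed
  qed
qed

text \<open>Up to time \<open>S\<close> the path runs through finitely many iterates.\<close>

lemma bounded_euler_path: "bounded (euler_path \<beta> ` {0..S})" if "\<beta> > 0"
proof (rule finite_imp_bounded, rule finite_subset)
  show "euler_path \<beta> ` {0..S} \<subseteq> euler_iter \<beta> ` {..nat \<lfloor>S / \<beta>\<rfloor>}"
    using that by (auto simp: euler_path_eq intro!: imageI nat_mono floor_mono divide_right_mono)
qed simp

text \<open>Uniform convergence confines the late paths to one ball, where \<open>V\<close> is
  bounded and uniformly continuous. Hence \<open>V\<close> along the paths tends uniformly to
  \<open>V\<close> along \<open>x\<close>, and the drift bound near \<open>t\<close> is the
  definition of the derivative.\<close>

lemma limit_of_euler_paths_solves_ode:
  fixes \<beta> :: "nat \<Rightarrow> real"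
  assumes cont: "continuous_on UNIV V"
    and \<beta>: "\<And>n. \<beta> n > 0" "\<beta> \<longlonglongrightarrow> 0"
    and lim: "uniform_limit {0..S} (\<lambda>n. euler_path (\<beta> n)) x sequentially"
  shows "ode_solution V S x"
proof -
  let ?P = "\<lambda>n. euler_path (\<beta> n)"
  have pointwise: "(\<lambda>n. ?P n t) \<longlonglongrightarrow> x t" if "t \<in> {0..S}" for t
    using lim that by (rule tendsto_uniform_limitI)
  have "\<exists>N. \<forall>n\<ge>N. \<forall>t\<in>{0..S}. dist (?P n t) (x t) < 1"
    using uniform_limitD[OF lim zero_less_one] unfolding eventually_sequentially .
  then obtain N where "\<forall>n\<ge>N. \<forall>t\<in>{0..S}. dist (?P n t) (x t) < 1" ..
  then have N: "dist (?P n t) (x t) < 1" if "n \<ge> N" "t \<in> {0..S}" for n t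
    using that by simp
  obtain R0 where R0: "\<And>t. t \<in> {0..S} \<Longrightarrow> norm (?P N t) \<le> R0"
    using bounded_euler_path[OF \<beta>(1)[of N], of S] unfolding bounded_iff by blast
  \<comment> \<open>One unit leads from path \<open>N\<close> to \<open>x\<close>, the other from
    \<open>x\<close> to any later path.\<close>
  define R where "R = R0 + 2"
  have x_bd: "x t \<in> cball 0 (R - 1)" if "t \<in> {0..S}" for t
    using R0[OF that] N[OF order_refl that] norm_triangle_sub[of "x t" "?P N t"]
    by (auto simp: R_def dist_norm norm_minus_commute)
  have P_bd: "?P n t \<in> cball 0 R" if "n \<ge> N" "t \<in> {0..S}" for n t
    using x_bd[OF that(2)] N[OF that] norm_triangle_sub[of "?P n t" "x t"]
    by (auto simp: dist_norm)
  have "bounded (V ` cball 0 R)"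
    using cont by (intro compact_imp_bounded compact_continuous_image) (auto intro: continuous_on_subset)
  then obtain B where B: "\<And>y. y \<in> cball 0 R \<Longrightarrow> norm (V y) \<le> B" and "B > 0"
    unfolding bounded_pos by (meson imageI)
  \<comment> \<open>The paths are step functions, so continuity of \<open>x\<close> is not inherited
    from them; it comes from the drift bound with \<open>v = 0\<close>.\<close>
  have lipschitz: "norm (x b - x a) \<le> (b - a) * B" if "0 \<le> a" "a \<le> b" "b \<le> S" for a b
  proof -
    have "\<forall>\<^sub>F n in sequentially. \<forall>r. 0 \<le> r \<longrightarrow> a - \<beta> n < r \<longrightarrow> r \<le> b \<longrightarrow> norm (V (?P n r) - 0) \<le> B"
      using eventually_ge_at_top[of N] by eventually_elim (use that B P_bd in auto)
    from limit_drift[OF \<beta> that(1,2) pointwise pointwise this] that show ?thesis by simp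
  qed
  have "B-lipschitz_on {0..S} x"
  proof (rule lipschitz_onI)
    show "0 \<le> B" using \<open>B > 0\<close> by simp
    fix a b assume "a \<in> {0..S}" "b \<in> {0..S}"
    then show "dist (x a) (x b) \<le> B * dist a b"
      using lipschitz[of a b] lipschitz[of b a]
      by (cases "a \<le> b") (auto simp: dist_norm norm_minus_commute mult.commute)
  qed
  then have cont_Vx: "continuous_on {0..S} (V \<circ> x)"
    using cont lipschitz_on_continuous_on by (intro continuous_on_compose) (auto intro: continuous_on_subset)
  have "uniform_limit {0..S} (\<lambda>n t. V (?P n t)) (V \<circ> x) sequentially"
  proof (rule uniform_limit_compose[OF lim])
    show "uniformly_continuous_on (cball 0 R) V"
      using cont by (intro compact_uniformly_continuous) (auto intro: continuous_on_subset)
    show "\<forall>\<^sub>F n in sequentially. ?P n ` {0..S} \<subseteq> cball 0 R"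
      using eventually_ge_at_top[of N] by eventually_elim (use P_bd in auto)
    show "x ` {0..S} \<subseteq> cball 0 R"
      using x_bd by fastforce
  qed
  note lim_V = uniform_limitD[OF this]
  have "(x has_vector_derivative V (x t)) (at t within {0..S})" if t: "t \<in> {0..S}" for t
    unfolding has_vector_derivative_def has_derivative_within_alt
  proof (intro conjI allI impI)
    fix e :: real assume "e > 0"
    obtain d where "d > 0" and d: "\<And>r. r \<in> {0..S} \<Longrightarrow> dist r t < d \<Longrightarrow> dist (V (x r)) (V (x t)) < e / 2"
      using cont_Vx[unfolded continuous_on_iff, rule_format, OF t half_gt_zero[OF \<open>e > 0\<close>]] by auto
    \<comment> \<open>The window reaches back to \<open>a - \<beta> n\<close>; with
      \<open>\<beta> n < d / 2\<close> all its times stay within \<open>d\<close> of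
      \<open>t\<close>. Half of \<open>e\<close> pays for the path against \<open>x\<close>, half
      for the variation of \<open>V\<close> along \<open>x\<close>.\<close>
    have drift: "norm (x b - x a - (b - a) *\<^sub>R V (x t)) \<le> (b - a) * e"
      if ab: "0 \<le> a" "a \<le> b" "b \<le> S" "t - d / 2 < a" "b < t + d / 2" for a b
    proof (rule limit_drift[OF \<beta> ab(1,2) pointwise pointwise])
      have "\<forall>\<^sub>F n in sequentially. \<beta> n < d / 2"
        using order_tendstoD(2)[OF \<beta>(2), of "d / 2"] \<open>d > 0\<close> by simp
      then show "\<forall>\<^sub>F n in sequentially. \<forall>r. 0 \<le> r \<longrightarrow> a - \<beta> n < r \<longrightarrow> r \<le> b \<longrightarrow>
          norm (V (?P n r) - V (x t)) \<le> e"
        using lim_V[OF half_gt_zero[OF \<open>e > 0\<close>]]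
      proof (eventually_elim, intro allI impI)
        fix n r
        assume n: "\<beta> n < d / 2" "\<forall>r\<in>{0..S}. dist (V (?P n r)) ((V \<circ> x) r) < e / 2"
          and r: "0 \<le> r" "a - \<beta> n < r" "r \<le> b"
        have rt: "r \<in> {0..S}" "dist r t < d"
          using n(1) r ab by (auto simp: dist_real_def)
        have "dist (V (x r)) (V (?P n r)) < e / 2"
          using n(2) rt(1) by (simp add: dist_commute)
        from dist_triangle_half_r[OF this d[OF rt]]
        have "dist (V (?P n r)) (V (x t)) < e" .
        then show "norm (V (?P n r) - V (x t)) \<le> e"
          by (simp add: dist_norm)
      qed
    qed (use ab in auto)
    show "\<exists>d>0. \<forall>s\<in>{0..S}. norm (s - t) < d \<longrightarrow>
        norm (x s - x t - (s - t) *\<^sub>R V (x t)) \<le> e * norm (s - t)"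
    proof (intro exI[of _ "d / 2"] conjI ballI impI)
      fix s assume s: "s \<in> {0..S}" "norm (s - t) < d / 2"
      \<comment> \<open>\<open>drift\<close> treats ordered times only; for \<open>s < t\<close> it
        is applied from \<open>s\<close> to \<open>t\<close> and the sign reversed.\<close>
      have swap: "x t - x s - (t - s) *\<^sub>R V (x t) = - (x s - x t - (s - t) *\<^sub>R V (x t))"
        by (simp add: algebra_simps)
      show "norm (x s - x t - (s - t) *\<^sub>R V (x t)) \<le> e * norm (s - t)"
        using drift[of t s] drift[of s t] s t \<open>d > 0\<close> unfolding swap norm_minus_cancel
        by (cases "t \<le> s") (auto simp: mult.commute abs_if)
    qed (use \<open>d > 0\<close> in simp)
  qed (rule bounded_linear_scaleR_left)
  then show ?thesis by (simp add: ode_solution_def)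
qed

section \<open>Convergence of Euler paths to a given solution\<close>

text \<open>One step commits an error of order \<beta> squared and amplifies the old error by at
  most \<open>1 + \<beta> * L\<close>; over about \<open>S / \<beta>\<close> steps this sums to
  order \<beta>. The Lipschitz constant holds only in a ball, so the same induction must keep the
  iterates inside it.\<close>

lemma euler_paths_converge_to_solution:
  assumes loc_lip: "local_lipschitz (UNIV :: real set) UNIV (\<lambda>_. V)"
    and sol: "ode_solution V S x" and x0: "x 0 = w0"
  shows "uniform_limit {0..S} euler_path x (at_right 0)"
proof -
  have deriv: "(x has_vector_derivative V (x t)) (at t within {0..S})" if "t \<in> {0..S}" for t
    using sol that by (simp add: ode_solution_def)
  have cont_V: "continuous_on UNIV V"
    using local_lipschitz_continuous_on[OF loc_lip, of 0] by simp
  have cont_x: "continuous_on {0..S} x"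
    using deriv has_vector_derivative_continuous
    unfolding continuous_on_eq_continuous_within by blast
  have "bounded (x ` {0..S})"
    using cont_x by (intro compact_imp_bounded compact_continuous_image) auto
  then obtain R where R: "\<And>t. t \<in> {0..S} \<Longrightarrow> norm (x t) \<le> R"
    unfolding bounded_iff by blast
  \<comment> \<open>The extra unit is the room left for iterates around the solution.\<close>
  define K :: "'a set" where "K = cball 0 (R + 1)"
  have "compact K" by (simp add: K_def)
  \<comment> \<open>\<open>V\<close> is autonomous; shrinking the time set to a single point makes
    it compact, as the uniform Lipschitz constant requires.\<close>
  have loc_lip_K: "local_lipschitz {0::real} K (\<lambda>_. V)"
    using local_lipschitz_subset[OF loc_lip, of "{0}" K] by simp
  obtain L where "L-lipschitz_on K V"
    using local_lipschitz_compact_implies_lipschitz[OF loc_lip_K \<open>compact K\<close>, of thesis] by auto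
  then have L: "\<And>y z. y \<in> K \<Longrightarrow> z \<in> K \<Longrightarrow> norm (V y - V z) \<le> L * norm (y - z)" and "L \<ge> 0"
    by (auto simp: lipschitz_on_def dist_norm)
  have "bounded (V ` K)"
    using cont_V \<open>compact K\<close> by (intro compact_imp_bounded compact_continuous_image) (auto intro: continuous_on_subset)
  then obtain B where B: "\<And>y. y \<in> K \<Longrightarrow> norm (V y) \<le> B" and "B > 0"
    unfolding bounded_pos by (meson imageI)
  have xK: "x t \<in> K" if "t \<in> {0..S}" for t
    using R[OF that] by (simp add: K_def)
  have x_lip: "norm (x b - x a) \<le> B * (b - a)" if "0 \<le> a" "a \<le> b" "b \<le> S" for a b
  proof -
    have "norm (x b - x a) \<le> B * norm (b - a)"
    proof (rule differentiable_bound[of "{a..b}"])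
      fix t assume t: "t \<in> {a..b}"
      then show "(x has_derivative (\<lambda>h. h *\<^sub>R V (x t))) (at t within {a..b})"
        using deriv[of t] that
        by (auto simp: has_vector_derivative_def[symmetric] intro: has_vector_derivative_within_subset)
      show "onorm (\<lambda>h. h *\<^sub>R V (x t)) \<le> B"
        using B[OF xK[of t]] t that
        by (intro onorm_le) (auto simp: mult.commute[of B] intro: mult_left_mono)
    qed (use that in auto)
    then show ?thesis using that by simp
  qed
  have consistency: "norm (x b - x a - (b - a) *\<^sub>R V (x a)) \<le> L * B * (b - a)\<^sup>2"
    if ab: "0 \<le> a" "a \<le> b" "b \<le> S" for a b
  proof -
    have "norm (x b - x a - (b - a) *\<^sub>R V (x a)) \<le> norm (b - a) * (L * (B * (b - a)))"
    proof (rule vector_differentiable_bound_linearization[of "{a..b}" x "\<lambda>t. V (x t)"])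
      fix t assume t: "t \<in> {a..b}"
      show "(x has_vector_derivative V (x t)) (at t within {a..b})"
        using deriv[of t] t ab by (auto intro: has_vector_derivative_within_subset)
      have "norm (V (x t) - V (x a)) \<le> L * norm (x t - x a)"
        using t ab by (intro L xK) auto
      also have "\<dots> \<le> L * (B * (b - a))"
        using x_lip[of a t] t ab \<open>L \<ge> 0\<close> \<open>B > 0\<close>
        by (intro mult_left_mono) (auto intro: order.trans)
      finally show "norm (V (x t) - V (x a)) \<le> L * (B * (b - a))" .
    qed (use ab in \<open>auto simp: closed_segment_eq_real_ivl\<close>)
    then show ?thesis
      using ab by (simp add: power2_eq_square mult_ac)
  qed
  have growth: "(1 + \<beta> * L) ^ k \<le> exp (S * L)" if "\<beta> > 0" "\<beta> * real k \<le> S" for \<beta> k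
  proof -
    have "(1 + \<beta> * L) ^ k \<le> exp (\<beta> * L) ^ k"
      using that \<open>L \<ge> 0\<close> by (intro power_mono) auto
    also have "\<dots> = exp (\<beta> * real k * L)"
      by (simp add: exp_of_nat_mult[symmetric] mult_ac)
    also have "\<dots> \<le> exp (S * L)"
      using that \<open>L \<ge> 0\<close> by (simp add: mult_right_mono)
    finally show ?thesis .
  qed
  \<comment> \<open>The bound is the closed form, starting from 0, of the recursion that multiplies
    by \<open>1 + \<beta> * L\<close> and adds \<open>L * B * \<beta>\<^sup>2\<close>; written
    without division by \<open>L\<close> it also covers \<open>L = 0\<close>. The second condition
    on \<beta> keeps the error at most 1, hence the iterate in \<open>K\<close>.\<close>
  have error: "norm (euler_iter \<beta> k - x (\<beta> * real k)) \<le> B * \<beta> * ((1 + \<beta> * L) ^ k - 1)"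
    if \<beta>: "\<beta> > 0" "B * \<beta> * exp (S * L) \<le> 1" and "\<beta> * real k \<le> S" for \<beta> k
    using that(3)
  proof (induction k)
    case 0
    then show ?case by (simp add: x0)
  next
    case (Suc k)
    define y t where "y = euler_iter \<beta> k" and "t = \<beta> * real k"
    have t': "\<beta> * real (Suc k) = t + \<beta>" by (simp add: t_def algebra_simps)
    have t: "0 \<le> t" "t + \<beta> \<le> S" "\<beta> * real k \<le> S"
      using Suc.prems \<beta>(1) by (auto simp: t_def algebra_simps)
    have IH: "norm (y - x t) \<le> B * \<beta> * ((1 + \<beta> * L) ^ k - 1)"
      using Suc.IH[OF t(3)] by (simp add: y_def t_def)
    also have "\<dots> \<le> B * \<beta> * exp (S * L)"
      using growth[OF \<beta>(1) t(3)] \<open>B > 0\<close> \<beta>(1) by (intro mult_left_mono) auto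
    finally have "norm (y - x t) \<le> 1" using \<beta>(2) by simp
    then have "y \<in> K"
      using R[of t] t \<beta>(1) norm_triangle_sub[of y "x t"] by (auto simp: K_def)
    \<comment> \<open>The local error: the exact flow over one step against an Euler step from the
      same point.\<close>
    define r where "r = x (t + \<beta>) - x t - \<beta> *\<^sub>R V (x t)"
    have r: "norm r \<le> L * B * \<beta>\<^sup>2"
      using consistency[of t "t + \<beta>"] t \<beta>(1) by (simp add: r_def)
    have "euler_iter \<beta> (Suc k) - x (t + \<beta>) = (y - x t) + \<beta> *\<^sub>R (V y - V (x t)) - r"
      by (simp add: y_def r_def algebra_simps)
    also have "norm \<dots> \<le> norm (y - x t) + norm (\<beta> *\<^sub>R (V y - V (x t))) + norm r"
      by (intro order.trans[OF norm_triangle_ineq4] add_right_mono norm_triangle_ineq)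
    also have "\<dots> \<le> norm (y - x t) + \<beta> * norm (V y - V (x t)) + L * B * \<beta>\<^sup>2"
      using r \<beta>(1) by simp
    also have "\<dots> \<le> norm (y - x t) + \<beta> * (L * norm (y - x t)) + L * B * \<beta>\<^sup>2"
      using L[OF \<open>y \<in> K\<close> xK[of t]] t \<beta>(1) by simp
    also have "\<dots> = (1 + \<beta> * L) * norm (y - x t) + L * B * \<beta>\<^sup>2"
      by (simp add: algebra_simps)
    also have "\<dots> \<le> (1 + \<beta> * L) * (B * \<beta> * ((1 + \<beta> * L) ^ k - 1)) + L * B * \<beta>\<^sup>2"
      using IH \<beta>(1) \<open>L \<ge> 0\<close> by (intro add_right_mono mult_left_mono) auto
    also have "\<dots> = B * \<beta> * ((1 + \<beta> * L) ^ Suc k - 1)"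
      by (simp add: algebra_simps power2_eq_square)
    finally show ?case unfolding t' .
  qed
  \<comment> \<open>\<open>B * exp (S * L)\<close> bounds the error at grid times; the further
    \<open>B\<close> accounts for the motion of \<open>x\<close> since the last grid time, while the
    path stands still.\<close>
  define C where "C = B * (exp (S * L) + 1)"
  have "C > 0" using \<open>B > 0\<close> by (simp add: C_def add_pos_pos)
  have path_error: "norm (euler_path \<beta> t - x t) \<le> C * \<beta>"
    if \<beta>: "\<beta> > 0" "B * \<beta> * exp (S * L) \<le> 1" and t: "t \<in> {0..S}" for \<beta> t
  proof -
    define k where "k = nat \<lfloor>t / \<beta>\<rfloor>"
    have k: "\<beta> * real k \<le> t" "t < \<beta> * real k + \<beta>"
      unfolding k_def using t by (intro floor_div_bounds[OF \<beta>(1)]; simp)+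
    have kS: "\<beta> * real k \<le> S" using k t by simp
    have "norm (euler_path \<beta> t - x t) \<le> norm (euler_iter \<beta> k - x (\<beta> * real k)) + norm (x t - x (\<beta> * real k))"
      using norm_triangle_ineq4[of "euler_iter \<beta> k - x (\<beta> * real k)" "x t - x (\<beta> * real k)"]
      by (simp add: euler_path_eq k_def)
    also have "\<dots> \<le> B * \<beta> * exp (S * L) + B * \<beta>"
    proof (rule add_mono)
      have "B * \<beta> * ((1 + \<beta> * L) ^ k - 1) \<le> B * \<beta> * exp (S * L)"
        using growth[OF \<beta>(1) kS] \<open>B > 0\<close> \<beta>(1) by (intro mult_left_mono) auto
      then show "norm (euler_iter \<beta> k - x (\<beta> * real k)) \<le> B * \<beta> * exp (S * L)"
        using error[OF \<beta> kS] by linarith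
      have "norm (x t - x (\<beta> * real k)) \<le> B * (t - \<beta> * real k)"
        using k t \<beta>(1) by (intro x_lip) auto
      also have "\<dots> \<le> B * \<beta>"
        using k \<open>B > 0\<close> by (intro mult_left_mono) auto
      finally show "norm (x t - x (\<beta> * real k)) \<le> B * \<beta>" .
    qed
    finally show ?thesis by (simp add: C_def algebra_simps)
  qed
  show ?thesis
  proof (rule uniform_limitI)
    fix e :: real assume "e > 0"
    \<comment> \<open>\<open>1 / C\<close> secures the smallness condition of
      \<open>path_error\<close>, \<open>e / C\<close> the final accuracy.\<close>
    define m where "m = min (1 / C) (e / C)"
    have "m > 0" using \<open>e > 0\<close> \<open>C > 0\<close> by (simp add: m_def)
    then have "\<forall>\<^sub>F \<beta> in at_right 0. \<beta> \<in> {0<..<m}"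
      by (rule eventually_at_right_real)
    then show "\<forall>\<^sub>F \<beta> in at_right 0. \<forall>t\<in>{0..S}. dist (euler_path \<beta> t) (x t) < e"
    proof eventually_elim
      case (elim \<beta>)
      then have \<beta>: "\<beta> > 0" "C * \<beta> < 1" "C * \<beta> < e"
        using \<open>C > 0\<close> by (auto simp: m_def field_simps)
      have "B * \<beta> * exp (S * L) \<le> C * \<beta>"
        using \<beta>(1) \<open>B > 0\<close> by (simp add: C_def algebra_simps)
      then have "B * \<beta> * exp (S * L) \<le> 1" using \<beta>(2) by linarith
      from path_error[OF \<beta>(1) this] show ?case
        unfolding dist_norm using \<beta>(3) by (intro ballI le_less_trans[OF _ \<beta>(3)])
    qed
  qed
qed

end

text \<open>For an Euler step the difference quotient equals \<open>V w\<close> exactly for every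
  positive \<beta>; the other two clauses are the two convergence results above.\<close>

proposition euler_step_continuous_time_limit:
  fixes V :: "'a::euclidean_space \<Rightarrow> 'a"
  shows "continuous_time_limit (\<lambda>\<beta> w. w + \<beta> *\<^sub>R V w) V"
proof -
  have quotient: "((\<lambda>\<beta>. (w + \<beta> *\<^sub>R V w - w) /\<^sub>R \<beta>) \<longlongrightarrow> V w) (at_right 0)" for w
  proof (rule tendsto_eventually)
    show "\<forall>\<^sub>F \<beta> in at_right 0. (w + \<beta> *\<^sub>R V w - w) /\<^sub>R \<beta> = V w"
      using eventually_at_right_less[of "0::real"] by eventually_elim simp
  qed
  \<comment> \<open>At time 0 no step has been made, so every path has the value \<open>w0\<close>
    there, and so does the limit.\<close>
  have "x 0 = w0" if "S > 0"
    and "uniform_limit {0..S} (\<lambda>n. iterate_path T (\<beta> n) w0) x sequentially"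
    for S :: real and w0 :: 'a and x T and \<beta> :: "nat \<Rightarrow> real"
    using tendsto_uniform_limitI[OF that(2), of 0] that(1)
    by (simp add: iterate_path_def LIMSEQ_const_iff)
  then show ?thesis
    unfolding continuous_time_limit_def
    using quotient euler_scheme.limit_of_euler_paths_solves_ode[of V]
      euler_scheme.euler_paths_converge_to_solution[of V]
    unfolding euler_scheme.euler_step_def[abs_def] by blast
qed

section \<open>Gradient of the MAML objective and the matrices \<open>maml_B\<close>\<close>

lemma expectation_finite_support:
  fixes h :: "'a \<Rightarrow> 'b::{banach, second_countable_topology}"
  assumes "finite A" and "set_pmf p \<subseteq> A"
  shows "measure_pmf.expectation p h = (\<Sum>a\<in>A. pmf p a *\<^sub>R h a)"
  using assms by (intro integral_measure_pmf) auto

lemma GDERIV_expectation: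
  fixes h :: "'b \<Rightarrow> 'a::euclidean_space \<Rightarrow> real"
  assumes "finite A" and "set_pmf p \<subseteq> A" and "\<And>a. a \<in> A \<Longrightarrow> GDERIV (h a) x :> D a"
  shows "GDERIV (\<lambda>w. measure_pmf.expectation p (\<lambda>a. h a w)) x :> measure_pmf.expectation p D"
  using assms(3)
  unfolding gderiv_def expectation_finite_support[OF assms(1,2)] inner_sum_right inner_scaleR_right
  by (auto intro!: derivative_eq_intros)

lemma hessian_symmetric:
  assumes "twice_differentiable f"
  shows "u \<bullet> (hessian f x *v v) = v \<bullet> (hessian f x *v u)"
  using assms unfolding twice_differentiable_def
  by (intro gradient_derivative_symmetric[of f "grad f" _ x] differentiable_GDERIV_grad
      has_derivative_grad_hessian) auto

lemma GDERIV_gradient_step: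
  assumes "twice_differentiable f"
  shows "GDERIV (\<lambda>w. f (w - \<alpha> *\<^sub>R grad f w)) x :>
    (mat 1 - \<alpha> *\<^sub>R hessian f x) *v grad f (x - \<alpha> *\<^sub>R grad f x)"
proof -
  let ?y = "x - \<alpha> *\<^sub>R grad f x"
  have f: "(f has_derivative (\<lambda>h. h \<bullet> grad f y)) (at y)" for y
    using assms differentiable_GDERIV_grad unfolding twice_differentiable_def gderiv_def by blast
  have g: "(grad f has_derivative (\<lambda>h. hessian f x *v h)) (at x)"
    using assms by (intro has_derivative_grad_hessian) (simp add: twice_differentiable_def)
  have "((\<lambda>w. f (w - \<alpha> *\<^sub>R grad f w)) has_derivative
      (\<lambda>h. (h - \<alpha> *\<^sub>R (hessian f x *v h)) \<bullet> grad f ?y)) (at x)"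
    by (rule has_derivative_compose[OF _ f]) (auto intro!: derivative_eq_intros g)
  \<comment> \<open>The chain rule puts the Hessian on the direction \<open>h\<close>; symmetry
    moves it onto the outer gradient without a transpose.\<close>
  moreover have "(h - \<alpha> *\<^sub>R (hessian f x *v h)) \<bullet> grad f ?y =
      h \<bullet> ((mat 1 - \<alpha> *\<^sub>R hessian f x) *v grad f ?y)" for h
    using hessian_symmetric[OF assms, of "grad f ?y" x h]
    by (simp add: matrix_vector_mult_diff_rdistrib scaleR_matrix_vector_assoc[symmetric]
        inner_diff_left inner_diff_right inner_commute)
  ultimately show ?thesis
    by (simp add: gderiv_def)
qed

text \<open>Component \<open>j\<close> of the gradient is a scalar function whose derivative is row
  \<open>j\<close> of the Hessian; its own intermediate point becomes \<open>z j\<close>.\<close>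

lemma grad_mean_value:
  assumes "twice_differentiable f"
  obtains z where "\<And>j. z j \<in> closed_segment a b"
    and "grad f b - grad f a = rowwise_hessian f z *v (b - a)"
proof -
  have "\<exists>z. z \<in> closed_segment a b \<and> grad f b $ j - grad f a $ j = (hessian f z *v (b - a)) $ j" for j
  proof -
    have deriv: "((\<lambda>y. grad f y $ j) has_derivative (\<lambda>h. (hessian f y *v h) $ j)) (at y)" for y
      by (rule bounded_linear.has_derivative[OF bounded_linear_vec_nth has_derivative_grad_hessian])
        (use assms in \<open>simp add: twice_differentiable_def\<close>)
    show ?thesis
      by (rule mvt_closed_segment[OF deriv, of a b]) (rule exI, rule conjI)
  qed
  then obtain z where z: "\<And>j. z j \<in> closed_segment a b"
    and eq: "\<And>j. grad f b $ j - grad f a $ j = (hessian f (z j) *v (b - a)) $ j"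
    by metis
  have "grad f b - grad f a = rowwise_hessian f z *v (b - a)"
    by (simp add: vec_eq_iff eq rowwise_hessian_def matrix_vector_mult_def)
  with z show thesis by (rule that)
qed

text \<open>With \<open>H\<close> the Hessian at \<open>w\<close> and \<open>R\<close> the row-wise
  one, the product of \<open>I - \<alpha> H\<close> and \<open>I - \<alpha> R\<close> is
  \<open>I - \<alpha> (H + R) + \<alpha>\<^sup>2 H R\<close>, that is, \<open>I\<close> minus
  \<open>maml_B\<close>.\<close>

lemma gradient_step_maml_B:
  assumes "grad f (w - \<alpha> *\<^sub>R grad f w) - grad f w = rowwise_hessian f z *v ((w - \<alpha> *\<^sub>R grad f w) - w)"
  shows "(mat 1 - \<alpha> *\<^sub>R hessian f w) *v grad f (w - \<alpha> *\<^sub>R grad f w)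
    = grad f w - maml_B \<alpha> f w z *v grad f w"
proof -
  let ?g = "grad f w" and ?H = "hessian f w" and ?R = "rowwise_hessian f z"
  have step: "grad f (w - \<alpha> *\<^sub>R ?g) = ?g - \<alpha> *\<^sub>R (?R *v ?g)"
    using assms by (simp add: algebra_simps matrix_vector_mult_scaleR linear_neg[OF matrix_vector_mul_linear])
  have expand: "(mat 1 - \<alpha> *\<^sub>R ?H) *v y = y - \<alpha> *\<^sub>R (?H *v y)" for y
    by (simp add: matrix_vector_mult_diff_rdistrib scaleR_matrix_vector_assoc[symmetric])
  show ?thesis
    unfolding step expand
    by (simp add: maml_B_def matrix_vector_mult_diff_rdistrib matrix_vector_mult_add_rdistrib
        scaleR_matrix_vector_assoc[symmetric] matrix_vector_mult_diff_distrib
        matrix_vector_mul_assoc power2_eq_square algebra_simps)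
qed

text \<open>As \<open>grad\<close> is a definite description, the first conjunct is what makes the
  right-hand side of the ODE a genuine gradient.\<close>

theorem proposition3p1:
  fixes f :: "nat \<Rightarrow> real ^ 'n \<Rightarrow> real" and p :: "nat pmf" and M :: nat and \<alpha> :: real
  assumes "\<And>i. i \<in> {1..M} \<Longrightarrow> twice_differentiable (f i)"
    and "set_pmf p \<subseteq> {1..M}"
    and "\<alpha> > 0"
  shows "(\<forall>w. GDERIV (maml_objective \<alpha> p f) w :>
            measure_pmf.expectation p (\<lambda>i.
              (mat 1 - \<alpha> *\<^sub>R hessian (f i) w) *v grad (f i) (w - \<alpha> *\<^sub>R grad (f i) w))) \<and>
         continuous_time_limit (maml_step \<alpha> p f) (\<lambda>w. - grad (maml_objective \<alpha> p f) w) \<and>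
         (\<exists>wt :: nat \<Rightarrow> 'n \<Rightarrow> real ^ 'n \<Rightarrow> real ^ 'n.
            (\<forall>i\<in>{1..M}. \<forall>j w. wt i j w \<in> closed_segment w (w - \<alpha> *\<^sub>R grad (f i) w)) \<and>
            (\<forall>w. - grad (maml_objective \<alpha> p f) w =
                 - grad (avg_loss p f) w +
                 measure_pmf.expectation p (\<lambda>i.
                   maml_B \<alpha> (f i) w (\<lambda>j. wt i j w) *v grad (f i) w)))"
proof -
  note f = assms(1) and supp = finite_atLeastAtMost assms(2)
  have objective: "GDERIV (maml_objective \<alpha> p f) w :> measure_pmf.expectation p (\<lambda>i.
      (mat 1 - \<alpha> *\<^sub>R hessian (f i) w) *v grad (f i) (w - \<alpha> *\<^sub>R grad (f i) w))" for w
    unfolding maml_objective_def[abs_def]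
    by (intro GDERIV_expectation[OF supp] GDERIV_gradient_step f)
  have loss: "GDERIV (avg_loss p f) w :> measure_pmf.expectation p (\<lambda>i. grad (f i) w)" for w
    unfolding avg_loss_def[abs_def]
    using f by (intro GDERIV_expectation[OF supp] differentiable_GDERIV_grad)
      (auto simp: twice_differentiable_def)
  have limit: "continuous_time_limit (maml_step \<alpha> p f) (\<lambda>w. - grad (maml_objective \<alpha> p f) w)"
    using euler_step_continuous_time_limit[of "\<lambda>w. - grad (maml_objective \<alpha> p f) w"]
    by (simp add: maml_step_def[abs_def])
  have "\<exists>z. (\<forall>j. z j \<in> closed_segment w (w - \<alpha> *\<^sub>R grad (f i) w)) \<and>
      grad (f i) (w - \<alpha> *\<^sub>R grad (f i) w) - grad (f i) w =
      rowwise_hessian (f i) z *v ((w - \<alpha> *\<^sub>R grad (f i) w) - w)" if "i \<in> {1..M}" for i w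
    using grad_mean_value[OF f[OF that]] by metis
  \<comment> \<open>Choice turns the intermediate points, found separately for each \<open>i\<close>
    and \<open>w\<close>, into functions of \<open>w\<close>.\<close>
  then obtain Z where segment: "\<And>i w j. i \<in> {1..M} \<Longrightarrow> Z i w j \<in> closed_segment w (w - \<alpha> *\<^sub>R grad (f i) w)"
    and mvt: "\<And>i w. i \<in> {1..M} \<Longrightarrow> grad (f i) (w - \<alpha> *\<^sub>R grad (f i) w) - grad (f i) w =
      rowwise_hessian (f i) (Z i w) *v ((w - \<alpha> *\<^sub>R grad (f i) w) - w)"
    by metis
  have "- grad (maml_objective \<alpha> p f) w = - grad (avg_loss p f) w +
      measure_pmf.expectation p (\<lambda>i. maml_B \<alpha> (f i) w (Z i w) *v grad (f i) w)" for w
    unfolding grad_eq[OF objective] grad_eq[OF loss] expectation_finite_support[OF supp]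
    by (simp add: gradient_step_maml_B[OF mvt] scaleR_diff_right sum_subtractf)
  then show ?thesis
    using objective limit segment by (intro conjI exI[of _ "\<lambda>i j w. Z i w j"]) auto
qed

end
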